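(* Let $L$ be a model and let $f:L\to L$ be $\alpha$-monotone for every $\alpha<\kappa$. Let $X\subseteq L$ be a set of post-fixed points of $f$ with respect to $\leq$ (i.e., $x\leq f(x)$ for all $x\in X$). Then there is a unique $y\in L$ such that $x\sqsubseteq y$ for all $x\in X$, $f(y)=y$, and for all $z\in L$, if $x\sqsubseteq z$ for all $x\in X$ and $f(z)\sqsubseteq z$, then $y\sqsubseteq z$.
   Context: Fix a limit ordinal $\kappa$. A stratified complete lattice is $(L,\leq,(\sqsubseteq_\alpha)_{\alpha<\kappa})$ with $(L,\leq)$ a complete lattice and each $\sqsubseteq_\alpha$ a preorder; $x=_\alpha y$ means $x\sqsubseteq_\alpha y$ and $y\sqsubseteq_\alpha x$. A model satisfies: (A1) for $\alpha<\beta<\kappa$, $x\sqsubseteq_\beta y$ implies $x=_\alpha y$; (A2) if $x=_\alpha y$ for all $\alpha$ then $x=y$; (A3) for all $x,\alpha$ there is $y$ with $x=_\alpha y$ such that $x\sqsubseteq_\alpha z$ implies $y\leq z$ (unique, denoted $x|_\alpha$); (A4) for nonempty $I$ and $x_i=_\alpha y$ ($i\in I$), $\bigvee_i x_i=_\alpha y$; (A5) $x\leq y$ implies $x|_\alpha\leq y|_\alpha$; (A6) if $x\leq y$ and $x=_\beta y$ for all $\beta<\alpha$ then $x\sqsubseteq_\alpha y$. On a model, define $x\sqsubseteq y$ iff $x=y$ or there is $\alpha<\kappa$ with $x\sqsubseteq_\alpha y$ and not $y\sqsubseteq_\alpha x$ (this is a partial order). A function $f:L\to L$ is $\alpha$-monotone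 if $x\sqsubseteq_\alpha y$ implies $f(x)\sqsubseteq_\alpha f(y)$. *)

theory Defs
  imports Main
begin

text \<open>
  The limit ordinal \<open>\<kappa>\<close> is represented by a type \<open>'k\<close> of sort \<open>{wellorder, no_top}\<close>, i.e. a
  (nonempty) well-order without a greatest element; \<open>\<alpha> < \<kappa>\<close> becomes \<open>\<alpha> :: 'k\<close>. The relation
  \<open>\<sqsubseteq>\<^sub>\<alpha>\<close> is written \<open>sq \<alpha>\<close>.
\<close>

definition eq_at :: "('k \<Rightarrow> 'a \<Rightarrow> 'a \<Rightarrow> bool) \<Rightarrow> 'k \<Rightarrow> 'a \<Rightarrow> 'a \<Rightarrow> bool" where
  "eq_at sq \<alpha> x y \<longleftrightarrow> sq \<alpha> x y \<and> sq \<alpha> y x"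

definition is_restr :: "('k \<Rightarrow> 'a::order \<Rightarrow> 'a \<Rightarrow> bool) \<Rightarrow> 'k \<Rightarrow> 'a \<Rightarrow> 'a \<Rightarrow> bool" where
  "is_restr sq \<alpha> x y \<longleftrightarrow> eq_at sq \<alpha> x y \<and> (\<forall>z. sq \<alpha> x z \<longrightarrow> y \<le> z)"

text \<open>The element \<open>x|\<^sub>\<alpha>\<close>; a meaningful value whenever axiom \<open>A3\<close> below holds.\<close>

definition restr :: "('k \<Rightarrow> 'a::order \<Rightarrow> 'a \<Rightarrow> bool) \<Rightarrow> 'k \<Rightarrow> 'a \<Rightarrow> 'a" where
  "restr sq \<alpha> x = (THE y. is_restr sq \<alpha> x y)"

lemma is_restr_unique: "is_restr sq \<alpha> x y \<Longrightarrow> is_restr sq \<alpha> x y' \<Longrightarrow> y = y'"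
  by (auto simp: is_restr_def eq_at_def intro: order.antisym)

lemma is_restr_restr: "\<exists>y. is_restr sq \<alpha> x y \<Longrightarrow> is_restr sq \<alpha> x (restr sq \<alpha> x)"
  unfolding restr_def by (rule theI') (blast intro: is_restr_unique)

locale stratified_complete_lattice =
  fixes sq :: "'k::{wellorder, no_top} \<Rightarrow> 'a::complete_lattice \<Rightarrow> 'a \<Rightarrow> bool"
  assumes sq_refl: "reflp (sq \<alpha>)"
    and sq_trans: "transp (sq \<alpha>)"

text \<open>In \<open>A4\<close> the nonempty family \<open>(x\<^sub>i)\<close> is given by its range.\<close>

locale model = stratified_complete_lattice sq
  for sq :: "'k::{wellorder, no_top} \<Rightarrow> 'a::complete_lattice \<Rightarrow> 'a \<Rightarrow> bool" +
  assumes A1: "\<alpha> < \<beta> \<Longrightarrow> sq \<beta> x y \<Longrightarrow> eq_at sq \<alpha> x y"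
    and A2: "(\<And>\<alpha>. eq_at sq \<alpha> x y) \<Longrightarrow> x = y"
    and A3: "\<exists>y. is_restr sq \<alpha> x y"
    and A4: "S \<noteq> {} \<Longrightarrow> (\<And>x. x \<in> S \<Longrightarrow> eq_at sq \<alpha> x y) \<Longrightarrow> eq_at sq \<alpha> (Sup S) y"
    and A5: "x \<le> y \<Longrightarrow> restr sq \<alpha> x \<le> restr sq \<alpha> y"
    and A6: "x \<le> y \<Longrightarrow> (\<And>\<beta>. \<beta> < \<alpha> \<Longrightarrow> eq_at sq \<beta> x y) \<Longrightarrow> sq \<alpha> x y"

definition sqle :: "('k \<Rightarrow> 'a \<Rightarrow> 'a \<Rightarrow> bool) \<Rightarrow> 'a \<Rightarrow> 'a \<Rightarrow> bool" where
  "sqle sq x y \<longleftrightarrow> x = y \<or> (\<exists>\<alpha>. sq \<alpha> x y \<and> \<not> sq \<alpha> y x)"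

end

theory Submission
  imports Defs
begin

text \<open>
  The fixed point is built level by level. Having fixed its classes modulo \<open>=\<^sub>\<beta>\<close> for \<open>\<beta> < \<alpha>\<close>, only
  the \<open>x \<in> X\<close> that agree with it so far still matter, and \<open>A6\<close> turns \<open>x \<le> f x\<close> into
  \<open>x \<sqsubseteq>\<^sub>\<alpha> f x\<close> for these. On the set of elements with the prescribed classes below \<open>\<alpha>\<close>, the preorder
  \<open>\<sqsubseteq>\<^sub>\<alpha>\<close> has a least element and suprema, so a Knaster--Tarski argument gives the least
  \<open>\<sqsubseteq>\<^sub>\<alpha>\<close>-pre-fixed point above these \<open>x\<close>; it is fixed modulo \<open>=\<^sub>\<alpha>\<close>. Finally the levels are glued
  together by taking the supremum of their restrictions.
\<close>

context model
begin

lemma refl_sq [simp]: "sq \<alpha> x x"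
  using sq_refl by (rule reflpD)

lemma trans_sq [trans]: "sq \<alpha> x y \<Longrightarrow> sq \<alpha> y z \<Longrightarrow> sq \<alpha> x z"
  using sq_trans by (rule transpD)

lemma eq_at_refl [simp]: "eq_at sq \<alpha> x x"
  by (simp add: eq_at_def)

lemma eq_at_sym: "eq_at sq \<alpha> x y \<Longrightarrow> eq_at sq \<alpha> y x"
  by (simp add: eq_at_def)

lemma eq_at_trans [trans]: "eq_at sq \<alpha> x y \<Longrightarrow> eq_at sq \<alpha> y z \<Longrightarrow> eq_at sq \<alpha> x z"
  unfolding eq_at_def using trans_sq by blast

lemma eq_at_antimono: "\<beta> \<le> \<alpha> \<Longrightarrow> eq_at sq \<alpha> x y \<Longrightarrow> eq_at sq \<beta> x y"
  using A1[of \<beta> \<alpha> x y] by (auto simp: eq_at_def order_le_less)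

lemma eq_at_restr: "eq_at sq \<alpha> (restr sq \<alpha> x) x"
  using is_restr_restr[OF A3] by (simp add: is_restr_def eq_at_sym)

lemma restr_le: "sq \<alpha> x z \<Longrightarrow> restr sq \<alpha> x \<le> z"
  using is_restr_restr[OF A3] by (simp add: is_restr_def)

text \<open>Two opposite strict relations cannot sit at the same level, and if they sit at different
  levels, \<open>A1\<close> turns the higher one into equivalence at the lower one.\<close>

lemma sqle_antisym: "sqle sq x y \<Longrightarrow> sqle sq y x \<Longrightarrow> x = y"
  unfolding sqle_def by (metis A1 eq_at_def linorder_neqE)

text \<open>A level where \<open>x\<close> is strictly below \<open>z\<close> cannot lie under
  \<alpha>, where the two are equivalent. At \<alpha> it is the claim, and beyond \<alpha> it gives
  equivalence at \<alpha> by \<open>A1\<close>.\<close>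

lemma sqle_imp_sq: "sqle sq x z \<Longrightarrow> (\<And>\<beta>. \<beta> < \<alpha> \<Longrightarrow> eq_at sq \<beta> x z) \<Longrightarrow> sq \<alpha> x z"
  unfolding sqle_def by (metis A1 eq_at_def linorder_neqE refl_sq)

text \<open>At the least level of inequivalence the assumption makes \<open>x\<close> strictly below
  \<open>y\<close>; if there is no such level, \<open>A2\<close> gives equality.\<close>

lemma sqleI_first_difference:
  assumes "\<And>\<alpha>. (\<And>\<beta>. \<beta> < \<alpha> \<Longrightarrow> eq_at sq \<beta> x y) \<Longrightarrow> sq \<alpha> x y"
  shows "sqle sq x y"
proof (cases "\<forall>\<alpha>. eq_at sq \<alpha> x y")
  case True
  then show ?thesis by (simp add: A2 sqle_def)
next
  case False
  then obtain \<alpha> where "\<not> eq_at sq \<alpha> x y" and min: "\<And>\<beta>. \<beta> < \<alpha> \<Longrightarrow> eq_at sq \<beta> x y"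
    using exists_least_iff[of "\<lambda>\<alpha>. \<not> eq_at sq \<alpha> x y"] by auto
  moreover have "sq \<alpha> x y" using min by (rule assms)
  ultimately show ?thesis by (auto simp: sqle_def eq_at_def)
qed

text \<open>Gluing of coherent classes: terms of index below \<beta> are dominated by the term at
  \<beta> and drop out of the supremum. The others are all equivalent to \<open>Y \<beta>\<close> at
  \<beta>, so \<open>A4\<close> applies.\<close>

lemma eq_at_Sup_restr:
  assumes coherent: "\<And>\<beta> \<gamma>. \<beta> \<in> A \<Longrightarrow> \<gamma> \<in> A \<Longrightarrow> \<beta> < \<gamma> \<Longrightarrow> eq_at sq \<beta> (Y \<gamma>) (Y \<beta>)"
    and "\<beta> \<in> A"
  shows "eq_at sq \<beta> (SUP \<gamma>\<in>A. restr sq \<gamma> (Y \<gamma>)) (Y \<beta>)"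
proof -
  let ?r = "\<lambda>\<gamma>. restr sq \<gamma> (Y \<gamma>)"
  have eq: "eq_at sq \<delta> (?r \<gamma>) (Y \<delta>)" if "\<delta> \<in> A" "\<gamma> \<in> A" "\<delta> \<le> \<gamma>" for \<gamma> \<delta>
  proof -
    have "eq_at sq \<delta> (?r \<gamma>) (Y \<gamma>)" using eq_at_antimono[OF \<open>\<delta> \<le> \<gamma>\<close> eq_at_restr] .
    also have "eq_at sq \<delta> (Y \<gamma>) (Y \<delta>)" using coherent that by (cases "\<delta> = \<gamma>") auto
    finally show ?thesis .
  qed
  have "?r \<gamma> \<le> Sup (?r ` {\<gamma>\<in>A. \<beta> \<le> \<gamma>})" if "\<gamma> \<in> A" for \<gamma>
  proof (cases "\<beta> \<le> \<gamma>")
    case True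
    then show ?thesis using that by (auto intro: SUP_upper)
  next
    case False
    \<comment> \<open>By coherence \<open>?r \<beta>\<close> is equivalent to
      \<open>Y \<gamma>\<close> at \<gamma>, and \<open>?r \<gamma>\<close> is \<le>-least among the
      elements above \<open>Y \<gamma>\<close> at that level.\<close>
    then have "?r \<gamma> \<le> ?r \<beta>"
      using eq[of \<gamma> \<beta>] \<open>\<beta> \<in> A\<close> that by (intro restr_le) (simp add: eq_at_def)
    also have "\<dots> \<le> Sup (?r ` {\<gamma>\<in>A. \<beta> \<le> \<gamma>})"
      using \<open>\<beta> \<in> A\<close> by (auto intro: SUP_upper)
    finally show ?thesis .
  qed
  then have "Sup (?r ` A) = Sup (?r ` {\<gamma>\<in>A. \<beta> \<le> \<gamma>})"
    by (intro order.antisym SUP_least SUP_subset_mono) auto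
  moreover have "eq_at sq \<beta> (Sup (?r ` {\<gamma>\<in>A. \<beta> \<le> \<gamma>})) (Y \<beta>)"
    using eq \<open>\<beta> \<in> A\<close> by (intro A4) auto
  ultimately show ?thesis by simp
qed

definition agrees :: "('k \<Rightarrow> 'a) \<Rightarrow> 'k \<Rightarrow> 'a \<Rightarrow> bool" where
  "agrees Y \<alpha> z \<longleftrightarrow> (\<forall>\<beta><\<alpha>. eq_at sq \<beta> z (Y \<beta>))"

lemma ex_lub_at:
  assumes "T \<noteq> {}"
    and "\<forall>t\<in>T. agrees Y \<alpha> t"
  shows "\<exists>s. agrees Y \<alpha> s \<and> (\<forall>t\<in>T. sq \<alpha> t s) \<and> (\<forall>z. (\<forall>t\<in>T. sq \<alpha> t z) \<longrightarrow> sq \<alpha> s z)"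
proof -
  have T: "eq_at sq \<beta> t (Y \<beta>)" if "t \<in> T" "\<beta> < \<alpha>" for t \<beta>
    using assms(2) that by (simp add: agrees_def)
  \<comment> \<open>Restricting first puts the supremum \<le>-below every
    \<open>sq \<alpha>\<close>-upper bound of \<open>T\<close>, so that \<open>A6\<close> can
    compare them.\<close>
  let ?s = "SUP t\<in>T. restr sq \<alpha> t"
  have restr_T: "eq_at sq \<beta> (restr sq \<alpha> t) (Y \<beta>)" if "t \<in> T" "\<beta> < \<alpha>" for t \<beta>
    using eq_at_antimono[OF less_imp_le[OF \<open>\<beta> < \<alpha>\<close>] eq_at_restr] T[OF that] by (rule eq_at_trans)
  have s: "eq_at sq \<beta> ?s (Y \<beta>)" if "\<beta> < \<alpha>" for \<beta>
    using \<open>T \<noteq> {}\<close> restr_T that by (intro A4) auto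
  have upper: "sq \<alpha> t ?s" if "t \<in> T" for t
  proof -
    have "sq \<alpha> t (restr sq \<alpha> t)" using eq_at_restr by (simp add: eq_at_def)
    also have "sq \<alpha> (restr sq \<alpha> t) ?s"
      using restr_T[OF that] s that by (intro A6 SUP_upper) (blast intro: eq_at_trans eq_at_sym)+
    finally show ?thesis .
  qed
  have "sq \<alpha> ?s z" if z: "\<forall>t\<in>T. sq \<alpha> t z" for z
  proof (rule A6)
    show "?s \<le> z" using z by (auto intro: SUP_least restr_le)
    \<comment> \<open>The bound \<open>z\<close> is not assumed to agree with \<open>Y\<close>; it
      does so through any \<open>t \<in> T\<close>, by \<open>A1\<close>.\<close>
    fix \<beta> assume "\<beta> < \<alpha>"
    obtain t where "t \<in> T" using \<open>T \<noteq> {}\<close> by blast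
    have "eq_at sq \<beta> ?s (Y \<beta>)" using \<open>\<beta> < \<alpha>\<close> by (rule s)
    also have "eq_at sq \<beta> (Y \<beta>) t" using T \<open>t \<in> T\<close> \<open>\<beta> < \<alpha>\<close> by (blast intro: eq_at_sym)
    also have "eq_at sq \<beta> t z" using A1 \<open>\<beta> < \<alpha>\<close> z \<open>t \<in> T\<close> by blast
    finally show "eq_at sq \<beta> ?s z" .
  qed
  with s upper show ?thesis unfolding agrees_def by blast
qed

text \<open>An \<open>x \<in> X\<close> that has left the prescribed classes imposes no condition,
  because its comparison was settled at an earlier level.\<close>

definition pre_fixed_at :: "('a \<Rightarrow> 'a) \<Rightarrow> 'a set \<Rightarrow> ('k \<Rightarrow> 'a) \<Rightarrow> 'k \<Rightarrow> 'a \<Rightarrow> bool" where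
  "pre_fixed_at f X Y \<alpha> z \<longleftrightarrow>
     agrees Y \<alpha> z \<and> sq \<alpha> (f z) z \<and> (\<forall>x\<in>X. agrees Y \<alpha> x \<longrightarrow> sq \<alpha> x z)"

text \<open>The conjunct \<open>sq \<alpha> y (f y)\<close> makes \<open>y\<close> fixed up to
  equivalence at \<alpha>, which the later levels rely on.\<close>

definition level :: "('a \<Rightarrow> 'a) \<Rightarrow> 'a set \<Rightarrow> ('k \<Rightarrow> 'a) \<Rightarrow> 'k \<Rightarrow> 'a \<Rightarrow> bool" where
  "level f X Y \<alpha> y \<longleftrightarrow> pre_fixed_at f X Y \<alpha> y \<and> sq \<alpha> y (f y) \<and>
     (\<forall>z. pre_fixed_at f X Y \<alpha> z \<longrightarrow> sq \<alpha> y z)"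

lemma ex_level:
  assumes mono: "\<And>\<alpha>. monotone (sq \<alpha>) (sq \<alpha>) f"
    and post: "\<And>x. x \<in> X \<Longrightarrow> x \<le> f x"
    and levels: "\<And>\<beta>. \<beta> < \<alpha> \<Longrightarrow> level f X Y \<beta> (Y \<beta>)"
  shows "\<exists>y. level f X Y \<alpha> y"
proof -
  have fixed: "eq_at sq \<beta> (f (Y \<beta>)) (Y \<beta>)" if "\<beta> < \<alpha>" for \<beta>
    using levels[OF that] by (simp add: level_def pre_fixed_at_def eq_at_def)
  have agrees_f: "agrees Y \<alpha> (f z)" if "agrees Y \<alpha> z" for z
    unfolding agrees_def
  proof (intro allI impI)
    fix \<beta> assume "\<beta> < \<alpha>"
    then have "eq_at sq \<beta> (f z) (f (Y \<beta>))"
      using that mono[of \<beta>] by (simp add: agrees_def eq_at_def monotoneD)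
    also have "eq_at sq \<beta> (f (Y \<beta>)) (Y \<beta>)" using \<open>\<beta> < \<alpha>\<close> by (rule fixed)
    finally show "eq_at sq \<beta> (f z) (Y \<beta>)" .
  qed
  have le_imp_sq: "sq \<alpha> u v" if "u \<le> v" "agrees Y \<alpha> u" "agrees Y \<alpha> v" for u v
    using that unfolding agrees_def by (blast intro: A6 eq_at_trans eq_at_sym)
  \<comment> \<open>The \<open>sq \<alpha>\<close>-least element agreeing with \<open>Y\<close>
    below \<alpha>; it makes \<open>T\<close> below nonempty. At the first level it is the bottom
    element.\<close>
  define b where "b = (SUP \<beta>\<in>{..<\<alpha>}. restr sq \<beta> (Y \<beta>))"
  have b: "agrees Y \<alpha> b"
    unfolding agrees_def b_def
    using levels by (auto simp: level_def pre_fixed_at_def agrees_def intro!: eq_at_Sup_restr)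
  have b_least: "sq \<alpha> b z" if "agrees Y \<alpha> z" for z
  proof -
    have "b \<le> z"
      unfolding b_def using that by (auto simp: agrees_def eq_at_def intro!: SUP_least restr_le)
    then show ?thesis using b that by (rule le_imp_sq)
  qed
  \<comment> \<open>Post-fixed points lying below all pre-fixed points. Since \<open>f\<close> maps
    their supremum back into \<open>T\<close>, it is itself pre-fixed, hence the least pre-fixed
    point; only suprema are used.\<close>
  define T where "T = {t. agrees Y \<alpha> t \<and> sq \<alpha> t (f t) \<and> (\<forall>z. pre_fixed_at f X Y \<alpha> z \<longrightarrow> sq \<alpha> t z)}"
  have "b \<in> T" using b b_least agrees_f by (auto simp: T_def pre_fixed_at_def)
  then have "T \<noteq> {}" by blast
  moreover have "\<forall>t\<in>T. agrees Y \<alpha> t" by (simp add: T_def)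
  ultimately obtain y where y: "agrees Y \<alpha> y"
    and ub: "\<And>t. t \<in> T \<Longrightarrow> sq \<alpha> t y"
    and lub: "\<And>z. \<forall>t\<in>T. sq \<alpha> t z \<Longrightarrow> sq \<alpha> y z"
    using ex_lub_at by meson
  have post_y: "sq \<alpha> y (f y)"
  proof (intro lub ballI)
    fix t assume "t \<in> T"
    then have "sq \<alpha> t (f t)" by (simp add: T_def)
    also have "sq \<alpha> (f t) (f y)" using mono ub[OF \<open>t \<in> T\<close>] by (rule monotoneD)
    finally show "sq \<alpha> t (f y)" .
  qed
  have least: "sq \<alpha> y z" if "pre_fixed_at f X Y \<alpha> z" for z
    using that by (intro lub) (simp add: T_def)
  have "sq \<alpha> (f y) z" if z: "pre_fixed_at f X Y \<alpha> z" for z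
  proof -
    have "sq \<alpha> (f y) (f z)" using mono least[OF z] by (rule monotoneD)
    also have "sq \<alpha> (f z) z" using z by (simp add: pre_fixed_at_def)
    finally show ?thesis .
  qed
  then have "f y \<in> T"
    using agrees_f y monotoneD[OF mono post_y] by (simp add: T_def)
  then have "sq \<alpha> (f y) y" by (rule ub)
  moreover have "sq \<alpha> x y" if "x \<in> X" "agrees Y \<alpha> x" for x
  proof (rule ub)
    \<comment> \<open>Both sides agree with \<open>Y\<close> below \<alpha>, so \<open>A6\<close>
      converts the hypothesis on \<le>.\<close>
    have "sq \<alpha> x (f x)" using that post agrees_f by (intro le_imp_sq)
    then show "x \<in> T" using that by (auto simp: T_def pre_fixed_at_def)
  qed
  ultimately show ?thesis
    using y post_y least by (auto simp: level_def pre_fixed_at_def)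
qed

text \<open>Well-founded recursion with choice: \<open>level\<close> determines its value only up to
  equivalence at \<alpha>, and it reads \<open>Y\<close> only strictly below \<alpha>.\<close>

lemma ex_levels:
  assumes "\<And>\<alpha>. monotone (sq \<alpha>) (sq \<alpha>) f"
    and "\<And>x. x \<in> X \<Longrightarrow> x \<le> f x"
  shows "\<exists>Y. \<forall>\<alpha>. level f X Y \<alpha> (Y \<alpha>)"
proof (rule dependent_wf_choice[OF wf, where P = "level f X"])
  fix Y Y' :: "'k \<Rightarrow> 'a" and \<alpha> r
  assume "\<And>\<beta>. (\<beta>, \<alpha>) \<in> {(x, y). x < y} \<Longrightarrow> Y \<beta> = Y' \<beta>"
  then have "agrees Y \<alpha> = agrees Y' \<alpha>" by (auto simp: agrees_def)
  then show "level f X Y \<alpha> r = level f X Y' \<alpha> r" by (simp add: level_def pre_fixed_at_def)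
qed (use ex_level[OF assms] in auto)

text \<open>For minimality, at any level below which \<open>y\<close> and \<open>z\<close> are
  equivalent, \<open>z\<close> is among the pre-fixed points over which \<open>Y \<alpha>\<close> is
  least.\<close>

theorem ex_least_fixed_point_above:
  assumes mono: "\<And>\<alpha>. monotone (sq \<alpha>) (sq \<alpha>) f"
    and post: "\<And>x. x \<in> X \<Longrightarrow> x \<le> f x"
  obtains y where "\<And>x. x \<in> X \<Longrightarrow> sqle sq x y" and "f y = y"
    and "\<And>z. (\<And>x. x \<in> X \<Longrightarrow> sqle sq x z) \<Longrightarrow> sqle sq (f z) z \<Longrightarrow> sqle sq y z"
proof -
  obtain Y where Y: "\<And>\<alpha>. level f X Y \<alpha> (Y \<alpha>)"
    using ex_levels[OF assms] by blast
  define y where "y = (SUP \<alpha>. restr sq \<alpha> (Y \<alpha>))"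
  have y: "eq_at sq \<alpha> y (Y \<alpha>)" for \<alpha>
    unfolding y_def
    using Y by (intro eq_at_Sup_restr) (auto simp: level_def pre_fixed_at_def agrees_def)
  have agreesI: "agrees Y \<alpha> z" if "\<And>\<beta>. \<beta> < \<alpha> \<Longrightarrow> eq_at sq \<beta> z y" for z \<alpha>
    using that y unfolding agrees_def by (blast intro: eq_at_trans)
  have agreesD: "eq_at sq \<beta> z y" if "agrees Y \<alpha> z" "\<beta> < \<alpha>" for z \<alpha> \<beta>
    using that y unfolding agrees_def by (blast intro: eq_at_trans eq_at_sym)
  have fy: "f y = y"
  proof (rule A2)
    fix \<alpha>
    have "eq_at sq \<alpha> (f y) (f (Y \<alpha>))"
      using y[of \<alpha>] mono[of \<alpha>] by (simp add: eq_at_def monotoneD)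
    also have "eq_at sq \<alpha> (f (Y \<alpha>)) (Y \<alpha>)"
      using Y[of \<alpha>] by (simp add: level_def pre_fixed_at_def eq_at_def)
    also have "eq_at sq \<alpha> (Y \<alpha>) y" using y by (rule eq_at_sym)
    finally show "eq_at sq \<alpha> (f y) y" .
  qed
  have above: "sqle sq x y" if "x \<in> X" for x
  proof (rule sqleI_first_difference)
    fix \<alpha> assume "\<And>\<beta>. \<beta> < \<alpha> \<Longrightarrow> eq_at sq \<beta> x y"
    then have "sq \<alpha> x (Y \<alpha>)"
      using Y[of \<alpha>] agreesI \<open>x \<in> X\<close> by (simp add: level_def pre_fixed_at_def)
    also have "sq \<alpha> (Y \<alpha>) y" using y by (simp add: eq_at_def)
    finally show "sq \<alpha> x y" .
  qed
  have "sqle sq y z" if X_z: "\<And>x. x \<in> X \<Longrightarrow> sqle sq x z" and f_z: "sqle sq (f z) z" for z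
  proof (rule sqleI_first_difference)
    fix \<alpha> assume yz: "\<And>\<beta>. \<beta> < \<alpha> \<Longrightarrow> eq_at sq \<beta> y z"
    \<comment> \<open>Monotonicity carries the equivalence of \<open>y\<close> and \<open>z\<close>
      to \<open>f y = y\<close> and \<open>f z\<close>, so \<open>f z\<close> and \<open>z\<close>
      cannot differ before \<alpha>.\<close>
    have "eq_at sq \<beta> (f z) z" if "\<beta> < \<alpha>" for \<beta>
    proof -
      have "eq_at sq \<beta> (f z) (f y)"
        using yz[OF that] mono[of \<beta>] by (simp add: eq_at_def monotoneD)
      also have "eq_at sq \<beta> (f y) z" using yz[OF that] fy by simp
      finally show ?thesis .
    qed
    with f_z have "sq \<alpha> (f z) z" by (rule sqle_imp_sq)
    moreover have "sq \<alpha> x z" if "x \<in> X" "agrees Y \<alpha> x" for x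
      using X_z[OF \<open>x \<in> X\<close>] agreesD[OF \<open>agrees Y \<alpha> x\<close>] yz
      by (blast intro: sqle_imp_sq eq_at_trans)
    ultimately have "pre_fixed_at f X Y \<alpha> z"
      using agreesI yz eq_at_sym by (simp add: pre_fixed_at_def)
    then have "sq \<alpha> (Y \<alpha>) z" using Y[of \<alpha>] by (simp add: level_def)
    moreover have "sq \<alpha> y (Y \<alpha>)" using y by (simp add: eq_at_def)
    ultimately show "sq \<alpha> y z" by (rule trans_sq[rotated])
  qed
  with above fy show thesis by (rule that)
qed

end

theorem theorem3:
  fixes sq :: "'k::{wellorder, no_top} \<Rightarrow> 'a::complete_lattice \<Rightarrow> 'a \<Rightarrow> bool"
    and f :: "'a \<Rightarrow> 'a" and X :: "'a set"
  assumes "model sq"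
    and "\<And>\<alpha>. monotone (sq \<alpha>) (sq \<alpha>) f"
    and "\<And>x. x \<in> X \<Longrightarrow> x \<le> f x"
  shows "\<exists>!y. (\<forall>x\<in>X. sqle sq x y) \<and> f y = y \<and>
           (\<forall>z. (\<forall>x\<in>X. sqle sq x z) \<and> sqle sq (f z) z \<longrightarrow> sqle sq y z)"
proof -
  interpret model sq by fact
  obtain y where y: "\<And>x. x \<in> X \<Longrightarrow> sqle sq x y" "f y = y"
    "\<And>z. (\<And>x. x \<in> X \<Longrightarrow> sqle sq x z) \<Longrightarrow> sqle sq (f z) z \<Longrightarrow> sqle sq y z"
    using ex_least_fixed_point_above[OF assms(2,3)] by blast
  have refl: "sqle sq u u" for u by (simp add: sqle_def)
  show ?thesis
  proof (rule ex1I[of _ y])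
    fix y'
    assume y': "(\<forall>x\<in>X. sqle sq x y') \<and> f y' = y' \<and>
      (\<forall>z. (\<forall>x\<in>X. sqle sq x z) \<and> sqle sq (f z) z \<longrightarrow> sqle sq y' z)"
    \<comment> \<open>By reflexivity a fixed point is pre-fixed, so each candidate can be inserted
      into the minimality of the other.\<close>
    then have "sqle sq y' y" using y(1,2) refl by simp
    moreover have "sqle sq y y'" using y' refl by (intro y(3)) simp_all
    ultimately show "y' = y" by (rule sqle_antisym)
  qed (use y in blast)
qed

end
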